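(* Let $\mathcal D=\{t\in\mathbb C:\ \mathrm{dist}(t,[0,T])\le r\}$, for some $r>0$, $T>0$, be a domain in the complex $t$-plane containing the interval $[0,T]$. If $f_0(t)$ is analytic in $\mathcal D$, then the series $$\sum_{n=0}^\infty\frac{(-1)^nx^n}{n!}\,f_0^{\left(\frac n2\right)}(t)$$ is entire in $x$ for $0\le t\le T$.
   Context: $f_0^{(n/2)}$ denotes the Riemann--Liouville fractional derivative (based at $0$) of order $n/2$. Explicitly, $f_0^{(n)}$ is the ordinary $n$-th derivative for integer $n\ge0$, and for $n\ge1$ $$f_0^{\left(n-\frac12\right)}(t)=\frac{\Gamma(\frac12)}{\pi}\left[\sum_{m=1}^n\frac{(-1)^{n-m}\,\Gamma\!\left(n-m+\frac12\right)}{t^{\,n-m+\frac12}\,\Gamma(\frac12)}\,f_0^{(m-1)}(0)+\int_0^t\frac{f_0^{(n)}(s)}{(t-s)^{1/2}}\,ds\right].$$ Thus the coefficient of $x^{2n}$ is $f_0^{(n)}(t)/(2n)!$ and the coefficient of $x^{2n-1}$ is $-f_0^{(n-1/2)}(t)/(2n-1)!$. "Entire in $x$" means that the series converges for all $x\in\mathbb C$ and defines an entire function of $x$.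
   Formalization: At t = 0 the explicit formula for the half-odd-order derivatives divides by zero (e.g. f_0 = 1), so the claim is undefined there unless f_0 vanishes identically; the formal version sets those derivatives to 0 at t = 0 and covers 0 < t ≤ T in full. *)

theory Defs
  imports "HOL-Complex_Analysis.Complex_Analysis"
begin

text \<open>
  Riemann--Liouville derivative of order \<open>n - 1/2\<close>, based at \<open>0\<close>. For \<open>n = 0\<close> the sum is
  empty and the expression is the half-integral of \<open>f\<close>, i.e. \<open>1 / Gamma (1/2)\<close> times the
  integral of \<open>f s / (t - s) powr (1/2)\<close> over \<open>0 \<le> s \<le> t\<close>. Lemma \<open>rl_deriv_minus_half_Suc\<close>
  below shows that, for \<open>f\<close> analytic near the interval and \<open>t > 0\<close>, the expression for general
  \<open>n\<close> is the \<open>n\<close>-th derivative of this half-integral.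

  Unless \<open>f\<close> vanishes identically near \<open>0\<close>, some of these expressions are singular at \<open>t = 0\<close>.
  There \<open>0 powr a = 0\<close> and \<open>x / 0 = 0\<close> make the sum vanish, and the integral is over a point,
  so the value assigned at \<open>t = 0\<close> is \<open>0\<close>.
\<close>

definition rl_deriv_minus_half :: "(complex \<Rightarrow> complex) \<Rightarrow> nat \<Rightarrow> real \<Rightarrow> complex" where
  "rl_deriv_minus_half f n t =
     of_real (Gamma (1/2) / pi) *
       ((\<Sum>m=1..n. of_real ((-1) ^ (n - m) * Gamma (real (n - m) + 1/2)
                              / (t powr (real (n - m) + 1/2) * Gamma (1/2)))
                    * (deriv ^^ (m - 1)) f 0)
        + integral {0..t} (\<lambda>s. (deriv ^^ n) f (of_real s) / of_real ((t - s) powr (1/2))))"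

text \<open>The derivative of order \<open>k/2\<close>; an odd \<open>k\<close> is written as \<open>k/2 = n - 1/2\<close>.\<close>

definition rl_half_deriv :: "(complex \<Rightarrow> complex) \<Rightarrow> nat \<Rightarrow> real \<Rightarrow> complex" where
  "rl_half_deriv f k t =
     (if even k then (deriv ^^ (k div 2)) f (of_real t)
      else rl_deriv_minus_half f ((k + 1) div 2) t)"

lemma half_integral_eq:
  fixes h :: "real \<Rightarrow> complex"
  assumes "0 < t" and cont: "continuous_on {0..t} h"
  shows "((\<lambda>s. h s / of_real ((t - s) powr (1/2))) has_integral
            of_real (2 * sqrt t) * integral {0..1} (\<lambda>v. h (t * (1 - v\<^sup>2)))) {0..t}"
proof -
  define k where "k = (\<lambda>v. h (t * (1 - v\<^sup>2)))"
  define \<Phi> where "\<Phi> = (\<lambda>v. integral {0..v} k)"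
  define F where "F = (\<lambda>s. - of_real (2 * sqrt t) * \<Phi> (sqrt (1 - s / t)))"
  have sub: "t * (1 - v\<^sup>2) \<in> {0..t}" if "v \<in> {0..1}" for v
    using that \<open>0 < t\<close> by (auto simp: power_le_one mult_le_cancel_left1)
  have contk: "continuous_on {0..1} k"
    unfolding k_def
    by (rule continuous_on_compose2[OF cont]) (use sub in \<open>auto intro!: continuous_intros\<close>)
  have cont\<Phi>: "continuous_on {0..1} \<Phi>"
    unfolding \<Phi>_def by (intro indefinite_integral_continuous_1 integrable_continuous_real contk)
  have contF: "continuous_on {0..t} F"
    unfolding F_def
    by (intro continuous_intros continuous_on_compose2[OF cont\<Phi>]) (use \<open>0 < t\<close> in auto)
  have derF: "(F has_vector_derivative h s / of_real ((t - s) powr (1/2))) (at s)"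
    if s: "s \<in> {0<..<t}" for s
  proof -
    have pos: "0 < 1 - s / t" "1 - s / t < 1" using s by auto
    define v where "v = sqrt (1 - s / t)"
    have v: "0 < v" "v < 1" "v\<^sup>2 = 1 - s / t" using pos by (auto simp: v_def)
    have "(\<Phi> has_vector_derivative k v) (at v within {0..1})"
      unfolding \<Phi>_def by (rule integral_has_vector_derivative[OF contk]) (use v in auto)
    then have d\<Phi>: "(\<Phi> has_vector_derivative k v) (at v)"
      using v by (simp add: at_within_Icc_at)
    have dv: "((\<lambda>s. sqrt (1 - s / t)) has_vector_derivative - 1 / (2 * t * v)) (at s)"
      unfolding has_real_derivative_iff_has_vector_derivative[symmetric] v_def
      by (rule derivative_eq_intros refl | use pos \<open>0 < t\<close> in \<open>force simp: field_simps\<close>)+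
    have "((\<Phi> \<circ> (\<lambda>s. sqrt (1 - s / t))) has_vector_derivative (- 1 / (2 * t * v)) *\<^sub>R k v) (at s)"
      by (rule vector_diff_chain_at[OF dv]) (use d\<Phi> in \<open>simp add: v_def\<close>)
    then have dF: "(F has_vector_derivative
                  - of_real (2 * sqrt t) * ((- 1 / (2 * t * v)) *\<^sub>R k v)) (at s)"
      unfolding F_def o_def by (rule has_vector_derivative_mult_right)
    moreover have "k v = h s"
      using v \<open>0 < t\<close> by (simp add: k_def)
    moreover have "2 * sqrt t * (1 / (2 * t * v)) = 1 / (t - s) powr (1/2)"
    proof -
      have "t - s = t * (1 - s / t)" using \<open>0 < t\<close> by (simp add: field_simps)
      then have "sqrt (t - s) = sqrt t * v" by (metis real_sqrt_mult v_def)
      moreover have "t = sqrt t * sqrt t" using \<open>0 < t\<close> by simp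
      ultimately show ?thesis using s v \<open>0 < t\<close>
        by (simp add: powr_half_sqrt field_simps)
    qed
    then have "of_real (2 * sqrt t) * (of_real (1 / (2 * t * v)) :: complex)
                = of_real (1 / (t - s) powr (1/2))"
      by (metis of_real_mult)
    moreover have "- of_real (2 * sqrt t) * ((- 1 / (2 * t * v)) *\<^sub>R h s)
                     = (of_real (2 * sqrt t) * of_real (1 / (2 * t * v))) * h s"
      by (simp add: scaleR_conv_of_real)
    ultimately have "- of_real (2 * sqrt t) * ((- 1 / (2 * t * v)) *\<^sub>R k v)
                       = of_real (1 / (t - s) powr (1/2)) * h s"
      by (simp only:)
    then have "- of_real (2 * sqrt t) * ((- 1 / (2 * t * v)) *\<^sub>R k v)
                 = h s / of_real ((t - s) powr (1/2))"
      by simp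
    with dF show ?thesis by (simp only:)
  qed
  have "((\<lambda>s. h s / of_real ((t - s) powr (1/2))) has_integral F t - F 0) {0..t}"
    using fundamental_theorem_of_calculus_interior[OF _ contF derF] \<open>0 < t\<close> by simp
  moreover have "F t - F 0 = of_real (2 * sqrt t) * integral {0..1} k"
    using \<open>0 < t\<close> by (simp add: F_def \<Phi>_def)
  ultimately show ?thesis by (simp add: k_def)
qed

lemma half_integral_has_vector_derivative:
  fixes h :: "real \<Rightarrow> complex"
  assumes t: "0 < t" "t < T"
    and der: "\<And>s. s \<in> {0..T} \<Longrightarrow> (h has_vector_derivative h' s) (at s)"
    and cont': "continuous_on {0..T} h'"
  shows "((\<lambda>t. integral {0..t} (\<lambda>s. h s / of_real ((t - s) powr (1/2)))) has_vector_derivative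
            h 0 / of_real (t powr (1/2))
            + integral {0..t} (\<lambda>s. h' s / of_real ((t - s) powr (1/2)))) (at t)"
proof -
  have cont: "continuous_on {0..T} h"
    using der by (meson continuous_at_imp_continuous_on has_vector_derivative_continuous)
  define A where "A = integral {0..1} (\<lambda>v. h (t * (1 - v\<^sup>2)))"
  define B where "B = integral {0..1} (\<lambda>v. h' (t * (1 - v\<^sup>2)))"
  define C where "C = integral {0..1} (\<lambda>v. of_real (1 - v\<^sup>2) * h' (t * (1 - v\<^sup>2)))"
  have sub: "x * (1 - v\<^sup>2) \<in> {0..T}" if "x \<in> {0<..<T}" "v \<in> {0..1}" for x v
  proof -
    have "x * (1 - v\<^sup>2) \<le> x" using that by (simp add: mult_le_cancel_left1)
    moreover have "0 \<le> x * (1 - v\<^sup>2)" using that by (simp add: power_le_one)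
    moreover have "x < T" using that by simp
    ultimately show ?thesis unfolding atLeastAtMost_iff by linarith
  qed
  have chain: "((\<lambda>x. h (x * (1 - v\<^sup>2))) has_vector_derivative
                 of_real (1 - v\<^sup>2) * h' (x * (1 - v\<^sup>2))) (at x)"
    if "x \<in> {0<..<T}" "v \<in> {0..1}" for x v
  proof -
    have "((\<lambda>x. x * (1 - v\<^sup>2)) has_vector_derivative (1 - v\<^sup>2)) (at x)"
      unfolding has_real_derivative_iff_has_vector_derivative[symmetric]
      by (auto intro!: derivative_eq_intros)
    from vector_diff_chain_at[OF this der[OF sub[OF that]]]
    show ?thesis by (simp add: o_def scaleR_conv_of_real)
  qed
  have contf: "continuous_on {0..1} (\<lambda>v. g (x * (1 - v\<^sup>2)))"
    if "x \<in> {0<..<T}" "continuous_on {0..T} g" for x and g :: "real \<Rightarrow> complex"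
    by (rule continuous_on_compose2[OF that(2)])
       (use sub that in \<open>auto intro!: continuous_intros\<close>)
  have tin: "t \<in> {0<..<T}" using t by auto
  have "((\<lambda>x. integral (cbox 0 1) (\<lambda>v. h (x * (1 - v\<^sup>2)))) has_vector_derivative
          integral (cbox 0 1) (\<lambda>v. of_real (1 - v\<^sup>2) * h' (t * (1 - v\<^sup>2)))) (at t within {0<..<T})"
  proof (rule leibniz_rule_vector_derivative)
    show "continuous_on ({0<..<T} \<times> cbox 0 1)
            (\<lambda>(x, v). of_real (1 - v\<^sup>2) * h' (x * (1 - v\<^sup>2)))"
      unfolding split_beta
      by (intro continuous_intros continuous_on_compose2[OF cont']) (use sub in auto)
  next
    fix x v :: real assume "x \<in> {0<..<T}" "v \<in> cbox 0 1"
    then show "((\<lambda>x. h (x * (1 - v\<^sup>2))) has_vector_derivative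
                 of_real (1 - v\<^sup>2) * h' (x * (1 - v\<^sup>2))) (at x within {0<..<T})"
      unfolding cbox_interval by (rule has_vector_derivative_at_within[OF chain])
  next
    fix x :: real assume x: "x \<in> {0<..<T}"
    show "(\<lambda>v. h (x * (1 - v\<^sup>2))) integrable_on cbox 0 1"
      unfolding cbox_interval by (rule integrable_continuous_real[OF contf[OF x cont]])
  qed (use tin in simp_all)
  then have dA: "((\<lambda>x. integral {0..1} (\<lambda>v. h (x * (1 - v\<^sup>2)))) has_vector_derivative C) (at t)"
    unfolding C_def cbox_interval at_within_open[OF tin open_greaterThanLessThan] .
  have dsq: "((\<lambda>x. of_real (2 * sqrt x)) has_vector_derivative
          (of_real (1 / sqrt t) :: complex)) (at t)"
    by (rule has_vector_derivative_of_real)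
       (use t in \<open>auto intro!: derivative_eq_intros simp: field_simps
          simp flip: has_real_derivative_iff_has_vector_derivative\<close>)
  have "((\<lambda>x. of_real (2 * sqrt x) * integral {0..1} (\<lambda>v. h (x * (1 - v\<^sup>2))))
          has_vector_derivative of_real (2 * sqrt t) * C + of_real (1 / sqrt t) * A) (at t)"
    unfolding A_def by (rule has_vector_derivative_mult[OF dsq dA])
  then have main: "((\<lambda>t. integral {0..t} (\<lambda>s. h s / of_real ((t - s) powr (1/2))))
          has_vector_derivative of_real (2 * sqrt t) * C + of_real (1 / sqrt t) * A) (at t)"
  proof (rule has_vector_derivative_transform_within_open[where S = "{0<..<T}"])
    fix x assume x: "x \<in> {0<..<T}"
    then have "continuous_on {0..x} h" by (auto intro: continuous_on_subset[OF cont])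
    with x show "of_real (2 * sqrt x) * integral {0..1} (\<lambda>v. h (x * (1 - v\<^sup>2)))
             = integral {0..x} (\<lambda>s. h s / of_real ((x - s) powr (1/2)))"
      using half_integral_eq[of x h] by (simp add: integral_unique)
  qed (use tin in auto)
  have "continuous_on {0..t} h'" using t by (auto intro: continuous_on_subset[OF cont'])
  then have I': "integral {0..t} (\<lambda>s. h' s / of_real ((t - s) powr (1/2))) = of_real (2 * sqrt t) * B"
    using half_integral_eq[of t h'] t by (simp add: B_def integral_unique)
  have parts: "A - of_real (2 * t) * (B - C) = h 0"
  proof -
    have "((\<lambda>v. h (t * (1 - v\<^sup>2)) - of_real (2 * t) *
             (h' (t * (1 - v\<^sup>2)) - of_real (1 - v\<^sup>2) * h' (t * (1 - v\<^sup>2))))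
           has_integral of_real 1 * h (t * (1 - 1\<^sup>2)) - of_real 0 * h (t * (1 - 0\<^sup>2))) {0..1}"
    proof (rule fundamental_theorem_of_calculus)
      fix v :: real assume v: "v \<in> {0..1}"
      have "((\<lambda>v. t * (1 - v\<^sup>2)) has_vector_derivative - 2 * t * v) (at v)"
        unfolding has_real_derivative_iff_has_vector_derivative[symmetric]
        by (auto intro!: derivative_eq_intros)
      from vector_diff_chain_at[OF this der[OF sub[OF tin v]]]
      have 1: "((\<lambda>v. h (t * (1 - v\<^sup>2))) has_vector_derivative
                 of_real (- 2 * t * v) * h' (t * (1 - v\<^sup>2))) (at v)"
        by (simp add: o_def scaleR_conv_of_real)
      have 2: "((\<lambda>v. of_real v) has_vector_derivative (of_real 1 :: complex)) (at v)"
        by (rule has_vector_derivative_of_real) (rule DERIV_ident)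
      have "((\<lambda>v. of_real v * h (t * (1 - v\<^sup>2))) has_vector_derivative
              h (t * (1 - v\<^sup>2)) - of_real (2 * t) *
             (h' (t * (1 - v\<^sup>2)) - of_real (1 - v\<^sup>2) * h' (t * (1 - v\<^sup>2)))) (at v)"
        using has_vector_derivative_mult[OF 2 1]
        by (simp add: algebra_simps power2_eq_square)
      then show "((\<lambda>v. of_real v * h (t * (1 - v\<^sup>2))) has_vector_derivative
              h (t * (1 - v\<^sup>2)) - of_real (2 * t) *
             (h' (t * (1 - v\<^sup>2)) - of_real (1 - v\<^sup>2) * h' (t * (1 - v\<^sup>2)))) (at v within {0..1})"
        by (rule has_vector_derivative_at_within)
    qed simp
    moreover have "of_real 1 * h (t * (1 - 1\<^sup>2)) - of_real 0 * h (t * (1 - 0\<^sup>2)) = h 0"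
      by simp
    ultimately have a: "((\<lambda>v. h (t * (1 - v\<^sup>2)) - of_real (2 * t) *
             (h' (t * (1 - v\<^sup>2)) - of_real (1 - v\<^sup>2) * h' (t * (1 - v\<^sup>2))))
           has_integral h 0) {0..1}" by (simp only:)
    have iA: "(\<lambda>v. h (t * (1 - v\<^sup>2))) integrable_on {0..1}"
      and iB: "(\<lambda>v. h' (t * (1 - v\<^sup>2))) integrable_on {0..1}"
      and iC: "(\<lambda>v. of_real (1 - v\<^sup>2) * h' (t * (1 - v\<^sup>2))) integrable_on {0..1}"
      by (intro integrable_continuous_real continuous_intros contf[OF tin cont] contf[OF tin cont'])+
    have "((\<lambda>v. h (t * (1 - v\<^sup>2)) - of_real (2 * t) *
             (h' (t * (1 - v\<^sup>2)) - of_real (1 - v\<^sup>2) * h' (t * (1 - v\<^sup>2))))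
           has_integral A - of_real (2 * t) * (B - C)) {0..1}"
      unfolding A_def B_def C_def
      by (intro has_integral_diff has_integral_mult_right integrable_integral iA iB iC)
    with a show ?thesis by (rule has_integral_unique[symmetric])
  qed
  define q :: complex where "q = of_real (sqrt t)"
  have q: "q \<noteq> 0" "of_real (2 * sqrt t) = 2 * q" "of_real (1 / sqrt t) = 1 / q"
      "of_real (t powr (1/2)) = q"
    using t by (simp_all add: q_def powr_half_sqrt)
  have "t = sqrt t * sqrt t" using real_sqrt_mult_self[of t] t(1) by linarith
  then have qq: "of_real (2 * t) = 2 * (q * q)"
    unfolding q_def by (metis of_real_mult of_real_numeral)
  have "2 * q * C + 1 / q * A = (A - 2 * (q * q) * (B - C)) / q + 2 * q * B"
    using q(1) by (simp add: field_simps)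
  then have "of_real (2 * sqrt t) * C + of_real (1 / sqrt t) * A
          = h 0 / of_real (t powr (1/2)) + of_real (2 * sqrt t) * B"
    unfolding parts[symmetric] q qq .
  with main I' show ?thesis by (simp only:)
qed

lemma rl_deriv_minus_half_Suc:
  assumes f: "f analytic_on closed_segment 0 (of_real T)" and t: "0 < t" "t < T"
  shows "(rl_deriv_minus_half f n has_vector_derivative rl_deriv_minus_half f (Suc n) t) (at t)"
proof -
  have seg: "of_real s \<in> closed_segment 0 (of_real T :: complex)" if "s \<in> {0..T}" for s
    using that closed_segment_of_real[of 0 T] t
    by (auto simp: closed_segment_eq_real_ivl)
  have an: "(deriv ^^ k) f analytic_on closed_segment 0 (of_real T)" for k
    by (rule analytic_higher_deriv[OF f])
  have der: "((\<lambda>s. (deriv ^^ n) f (of_real s)) has_vector_derivative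
               (deriv ^^ Suc n) f (of_real s)) (at s)" if "s \<in> {0..T}" for s
  proof -
    have "(deriv ^^ n) f analytic_on {of_real s}"
      using an seg[OF that] by (meson analytic_on_analytic_at)
    then have "((deriv ^^ n) f has_field_derivative (deriv ^^ Suc n) f (of_real s)) (at (of_real s))"
      by (simp add: analytic_on_imp_differentiable_at DERIV_deriv_iff_field_differentiable)
    then show ?thesis
      by (rule has_vector_derivative_real_field)
  qed
  have cont: "continuous_on {0..T} (\<lambda>s. (deriv ^^ Suc n) f (of_real s))"
    by (rule continuous_on_compose2[OF analytic_imp_holomorphic[OF an,
          THEN holomorphic_on_imp_continuous_on]])
       (use seg in \<open>auto intro!: continuous_intros\<close>)
  define c where "c = (\<lambda>j t. (-1) ^ j * Gamma (real j + 1/2) / (t powr (real j + 1/2) * Gamma (1/2)))"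
  have G: "Gamma (1/2 :: real) \<noteq> 0"
    by (simp add: Gamma_one_half_real)
  have dc: "((\<lambda>t. of_real (c j t)) has_vector_derivative (of_real (c (Suc j) t) :: complex)) (at t)" for j
  proof (rule has_vector_derivative_of_real)
    have GS: "Gamma (real (Suc j) + 1/2) = (real j + 1/2) * Gamma (real j + 1/2)"
    proof -
      have "real j + 1/2 \<notin> \<int>\<^sub>\<le>\<^sub>0"
        by (auto dest!: nonpos_Ints_nonpos)
      from Gamma_plus1[OF this] show ?thesis by (simp add: add_ac)
    qed
    have c_eq: "c j t = (-1) ^ j * Gamma (real j + 1/2) / Gamma (1/2) * t powr (- (real j + 1/2))" for j t
      by (simp add: c_def powr_minus field_simps)
    have "((\<lambda>t. (-1) ^ j * Gamma (real j + 1/2) / Gamma (1/2) * t powr (- (real j + 1/2)))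
            has_real_derivative (-1) ^ j * Gamma (real j + 1/2) / Gamma (1/2) *
              (- (real j + 1/2) * t powr (- (real j + 1/2) - 1))) (at t)"
      using t by (intro DERIV_cmult has_real_derivative_powr) auto
    moreover have "(-1) ^ j * Gamma (real j + 1/2) / Gamma (1/2) *
              (- (real j + 1/2) * t powr (- (real j + 1/2) - 1)) = c (Suc j) t"
    proof -
      have exp: "- (real j + 1/2) - 1 = - (real (Suc j) + 1/2)" by simp
      have "p * g / d * (- a * y) = (- 1 * p) * (a * g) / d * y" for p g d a y :: real
        by simp
      then show ?thesis unfolding c_eq GS exp power_Suc .
    qed
    ultimately show "(c j has_real_derivative c (Suc j) t) (at t)"
      by (simp only: c_eq[abs_def])
  qed
  define S where "S = (\<lambda>t. \<Sum>m=1..n. of_real (c (n - m) t) * (deriv ^^ (m - 1)) f 0)"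
  define I where "I = (\<lambda>n t. integral {0..t}
                        (\<lambda>s. (deriv ^^ n) f (of_real s) / of_real ((t - s) powr (1/2))))"
  have dS: "(S has_vector_derivative
              (\<Sum>m=1..n. of_real (c (Suc n - m) t) * (deriv ^^ (m - 1)) f 0)) (at t)"
    unfolding S_def
  proof (rule has_vector_derivative_sum)
    fix m assume "m \<in> {1..n}"
    then have "Suc n - m = Suc (n - m)" by auto
    then show "((\<lambda>t. of_real (c (n - m) t) * (deriv ^^ (m - 1)) f 0) has_vector_derivative
             of_real (c (Suc n - m) t) * (deriv ^^ (m - 1)) f 0) (at t)"
      using has_vector_derivative_mult_left[OF dc] by simp
  qed
  have dI: "(I n has_vector_derivative (deriv ^^ n) f 0 / of_real (t powr (1/2)) + I (Suc n) t) (at t)"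
    unfolding I_def
    using half_integral_has_vector_derivative[OF t der cont] by simp
  have "((\<lambda>t. of_real (Gamma (1/2) / pi) * (S t + I n t)) has_vector_derivative
          of_real (Gamma (1/2) / pi) *
            ((\<Sum>m=1..n. of_real (c (Suc n - m) t) * (deriv ^^ (m - 1)) f 0)
             + ((deriv ^^ n) f 0 / of_real (t powr (1/2)) + I (Suc n) t))) (at t)"
    by (intro has_vector_derivative_mult_right has_vector_derivative_add dS dI)
  moreover have "rl_deriv_minus_half f n = (\<lambda>t. of_real (Gamma (1/2) / pi) * (S t + I n t))"
    by (simp add: fun_eq_iff rl_deriv_minus_half_def S_def I_def c_def)
  moreover have "rl_deriv_minus_half f (Suc n) t =
      of_real (Gamma (1/2) / pi) *
            ((\<Sum>m=1..n. of_real (c (Suc n - m) t) * (deriv ^^ (m - 1)) f 0)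
             + ((deriv ^^ n) f 0 / of_real (t powr (1/2)) + I (Suc n) t))"
    using G by (simp add: rl_deriv_minus_half_def I_def c_def)
  ultimately show ?thesis by simp
qed

end

theory Submission
  imports Defs
begin

text \<open>
  Cauchy's inequality on discs of radius \<open>r\<close> gives \<open>f\<^sup>(\<^sup>n\<^sup>)(t) = O(n! / r\<^sup>n)\<close> on \<open>[0, T]\<close>. Fed into
  the explicit formula, this bounds the derivative of order \<open>k/2\<close> at a fixed \<open>t\<close> by
  \<open>A * q ^ k * n!\<close> with \<open>n = (k + 1) div 2\<close>. As \<open>k! \<ge> n! * (k div 2)!\<close>, the series is dominated
  by that of \<open>(q * x) ^ k / (k div 2)!\<close>, which converges for every \<open>x\<close>.
\<close>

text \<open>With \<open>z = 2 * y\<close>, the quotient \<open>z ^ k / fact (k div 2)\<close> stays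
  below \<open>z * exp (z^2)\<close>, because \<open>(z^2) ^ j / fact j\<close> is a single term of
  the exponential series. Undoing the doubling gives the factor \<open>(1/2) ^ k\<close> of a
  geometric majorant.\<close>

lemma summable_power_div_fact_half:
  fixes y :: real
  assumes "1 \<le> y"
  shows "summable (\<lambda>k. y ^ k / fact (k div 2))"
proof -
  define z where "z = 2 * y"
  have z: "1 \<le> z" using assms by (simp add: z_def)
  have "norm (y ^ k / fact (k div 2)) \<le> z * exp (z\<^sup>2) * (1/2) ^ k" for k
  proof -
    \<comment> \<open>The exponent is exact for odd \<open>k\<close> and one too large for even
      \<open>k\<close>; since \<open>1 \<le> z\<close>, both parities are covered at once.\<close>
    have "z ^ k \<le> z ^ (Suc (2 * (k div 2)))"
      by (rule power_increasing) (use z in auto)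
    also have "\<dots> = z * (z\<^sup>2) ^ (k div 2)" by (simp add: power_mult)
    finally have "z ^ k / fact (k div 2) \<le> z * ((z\<^sup>2) ^ (k div 2) / fact (k div 2))"
      by (simp add: divide_right_mono)
    also have "(z\<^sup>2) ^ (k div 2) / fact (k div 2) \<le> exp (z\<^sup>2)"
    proof -
      have "(\<Sum>n\<in>{k div 2}. (z\<^sup>2) ^ n / fact n) \<le> (\<Sum>n. (z\<^sup>2) ^ n / fact n)"
        using summable_exp[of "z\<^sup>2"]
        by (intro sum_le_suminf) (simp_all add: field_simps)
      then show ?thesis by (simp add: exp_def field_simps)
    qed
    finally have "z ^ k / fact (k div 2) \<le> z * exp (z\<^sup>2)" using z by simp
    then have "z ^ k / fact (k div 2) * (1/2) ^ k \<le> z * exp (z\<^sup>2) * (1/2) ^ k"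
      by (rule mult_right_mono) simp
    moreover have "z ^ k / fact (k div 2) * (1/2) ^ k = y ^ k / fact (k div 2)"
      by (simp add: z_def power_mult_distrib power_one_over field_simps)
    ultimately show ?thesis using assms by simp
  qed
  then show ?thesis
    by (rule summable_comparison_test'[where N = 0, rotated])
       (intro summable_mult summable_geometric, simp)
qed

text \<open>Isolates the growth that the coefficients may have: half of \<open>fact k\<close> pays
  for the growth of \<open>c k\<close>, and the other half still beats every geometric
  sequence.\<close>

lemma entire_of_fact_half_bound:
  fixes c :: "nat \<Rightarrow> complex"
  assumes bound: "\<And>k. norm (c k) \<le> A * q ^ k * fact ((k + 1) div 2)" and q: "1 \<le> q"
  shows "summable (\<lambda>k. (-1) ^ k * x ^ k / fact k * c k)"
    and "(\<lambda>x. \<Sum>k. (-1) ^ k * x ^ k / fact k * c k) holomorphic_on UNIV"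
proof -
  have A: "0 \<le> A"
    using order_trans[OF norm_ge_zero bound[of 0]] by simp
  have *: "summable (\<lambda>k. (-1) ^ k * x ^ k / fact k * c k)" for x
  proof -
    \<comment> \<open>The maximum with 1 secures \<open>1 \<le> y\<close>, as the summability lemma
      requires, also for small \<open>x\<close>.\<close>
    define y where "y = q * max 1 (norm x)"
    have "q * 1 \<le> y" unfolding y_def using q by (intro mult_left_mono) auto
    then have y: "1 \<le> y" "0 \<le> y" using q by auto
    have "norm ((-1) ^ k * x ^ k / fact k * c k) \<le> A * (y ^ k / fact (k div 2))" for k
    proof -
      \<comment> \<open>Upper and lower half of \<open>k\<close> add up to \<open>k\<close>, so the
        product of their factorials divides \<open>fact k\<close>, the quotient being a binomial
        coefficient.\<close>
      have k: "(k + 1) div 2 + k div 2 = k" by presburger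
      have "fact ((k + 1) div 2) * fact (k div 2) dvd (fact k :: nat)"
        using fact_fact_dvd_fact[of "(k + 1) div 2" "k div 2"] unfolding k .
      then have "fact ((k + 1) div 2) * fact (k div 2) \<le> (fact k :: nat)"
        by (rule dvd_imp_le) simp
      then have "real (fact ((k + 1) div 2) * fact (k div 2)) \<le> real (fact k)"
        by (rule of_nat_mono)
      then have f: "(fact ((k + 1) div 2) / fact k :: real) \<le> 1 / fact (k div 2)"
        by (simp add: field_simps)
      have "norm ((-1) ^ k * x ^ k / fact k * c k) = norm x ^ k / fact k * norm (c k)"
        by (simp add: norm_mult norm_divide norm_power)
      also have "\<dots> \<le> max 1 (norm x) ^ k / fact k * (A * q ^ k * fact ((k + 1) div 2))"
        by (intro mult_mono divide_right_mono power_mono bound) auto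
      also have "\<dots> = A * y ^ k * (fact ((k + 1) div 2) / fact k)"
        by (simp add: y_def power_mult_distrib)
      also have "\<dots> \<le> A * y ^ k * (1 / fact (k div 2))"
        by (rule mult_left_mono[OF f]) (use A y in simp)
      finally show ?thesis by simp
    qed
    then show ?thesis
      by (rule summable_comparison_test'[where N = 0, rotated])
         (intro summable_mult summable_power_div_fact_half y)
  qed
  then show "summable (\<lambda>k. (-1) ^ k * x ^ k / fact k * c k)" .
  \<comment> \<open>A power series that converges at each point of a disc about its centre is
    holomorphic there; these discs exhaust the plane.\<close>
  have "(\<lambda>x. \<Sum>k. (-1) ^ k * x ^ k / fact k * c k) holomorphic_on ball 0 R" for R
  proof (rule power_series_holomorphic[where a = "\<lambda>k. (-1) ^ k / fact k * c k"])
    fix w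
    show "(\<lambda>k. (-1) ^ k / fact k * c k * (w - 0) ^ k) sums
            (\<Sum>k. (-1) ^ k * w ^ k / fact k * c k)"
      using summable_sums[OF *[of w]] by (simp add: mult_ac)
  qed
  then have "(\<lambda>x. \<Sum>k. (-1) ^ k * x ^ k / fact k * c k) holomorphic_on (\<Union>R. ball 0 R)"
    by (intro holomorphic_on_UN_open) auto
  moreover have "(\<Union>R. ball 0 R) = (UNIV :: complex set)"
    using gt_ex by (auto simp: ball_def)
  ultimately show "(\<lambda>x. \<Sum>k. (-1) ^ k * x ^ k / fact k * c k) holomorphic_on UNIV"
    by simp
qed

text \<open>The quotient is the product of the factors \<open>j - 1/2\<close> for \<open>j\<close>
  from 1 to \<open>i\<close>, each of which is at most \<open>j\<close>.\<close>

lemma Gamma_add_half_le_fact: "Gamma (real i + 1/2) / Gamma (1/2) \<le> fact i"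
proof (induction i)
  case (Suc i)
  have "real i + 1/2 \<notin> \<int>\<^sub>\<le>\<^sub>0" by (auto dest!: nonpos_Ints_nonpos)
  from Gamma_plus1[OF this]
  have "Gamma (real (Suc i) + 1/2) = (real i + 1/2) * Gamma (real i + 1/2)"
    by (simp add: add_ac)
  then have "Gamma (real (Suc i) + 1/2) / Gamma (1/2)
               = (real i + 1/2) * (Gamma (real i + 1/2) / Gamma (1/2))" by simp
  also have "\<dots> \<le> real (Suc i) * fact i"
    by (intro mult_mono Suc.IH divide_nonneg_nonneg less_imp_le[OF Gamma_real_pos]) auto
  finally show ?case by simp
qed (simp add: Gamma_one_half_real)

text \<open>The substitution \<open>s = t * (1 - v^2)\<close> removes the singularity at
  \<open>s = t\<close>, leaving the factor \<open>2 * sqrt t\<close> and a continuous integrand on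
  the unit interval.\<close>

lemma norm_half_integral_le:
  fixes h :: "real \<Rightarrow> complex"
  assumes t: "0 < t" and cont: "continuous_on {0..t} h"
    and bound: "\<And>s. s \<in> {0..t} \<Longrightarrow> norm (h s) \<le> B"
  shows "norm (integral {0..t} (\<lambda>s. h s / of_real ((t - s) powr (1/2)))) \<le> 2 * sqrt t * B"
proof -
  have sub: "t * (1 - v\<^sup>2) \<in> {0..t}" if "v \<in> {0..1}" for v
    using that t by (auto simp: power_le_one mult_le_cancel_left1)
  have "norm (integral {0..1} (\<lambda>v. h (t * (1 - v\<^sup>2)))) \<le> B * (1 - 0)"
  proof (rule integral_bound)
    show "continuous_on {0..1} (\<lambda>v. h (t * (1 - v\<^sup>2)))"
      by (rule continuous_on_compose2[OF cont]) (use sub in \<open>auto intro!: continuous_intros\<close>)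
  qed (use sub bound in auto)
  then have "2 * sqrt t * norm (integral {0..1} (\<lambda>v. h (t * (1 - v\<^sup>2)))) \<le> 2 * sqrt t * B"
    by (intro mult_left_mono) (use t in auto)
  moreover have "integral {0..t} (\<lambda>s. h s / of_real ((t - s) powr (1/2)))
      = of_real (2 * sqrt t) * integral {0..1} (\<lambda>v. h (t * (1 - v\<^sup>2)))"
    by (rule integral_unique[OF half_integral_eq[OF t cont]])
  moreover have "norm (of_real (2 * sqrt t) :: complex) = 2 * sqrt t"
    using t by (simp add: norm_mult)
  ultimately show ?thesis by (simp only: norm_mult)
qed

text \<open>The boundary terms contain negative powers of \<open>t\<close>: the integer part is
  absorbed by \<open>1 / t \<le> q\<close>, and \<open>1 / sqrt t\<close> remains in the constant.
  The integral contributes \<open>2 * sqrt t\<close>. The constant may depend on \<open>t\<close>,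
  since \<open>t\<close> is fixed in the series.\<close>

lemma norm_rl_deriv_minus_half_le:
  assumes f: "f analytic_on closed_segment 0 (of_real t)" and t: "0 < t"
    and bound: "\<And>n s. s \<in> {0..t} \<Longrightarrow> norm ((deriv ^^ n) f (of_real s)) \<le> M * p ^ n * fact n"
    and q: "1 \<le> q" "0 \<le> p" "p \<le> q" "1 / t \<le> q"
  shows "norm (rl_deriv_minus_half f n t) \<le> M * (1 / sqrt t + 2 * sqrt t) * q ^ n * fact n"
proof -
  have M: "0 \<le> M"
    using order_trans[OF norm_ge_zero bound[of 0 0]] t by simp
  have bq: "norm ((deriv ^^ n) f (of_real s)) \<le> M * q ^ n * fact n" if "s \<in> {0..t}" for n s
    by (rule order_trans[OF bound[OF that]])
       (intro mult_right_mono mult_left_mono power_mono q M, simp)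
  define S where "S = (\<Sum>m=1..n. of_real ((-1) ^ (n - m) * Gamma (real (n - m) + 1/2)
                              / (t powr (real (n - m) + 1/2) * Gamma (1/2)))
                    * (deriv ^^ (m - 1)) f 0)"
  define I where "I = integral {0..t} (\<lambda>s. (deriv ^^ n) f (of_real s) / of_real ((t - s) powr (1/2)))"
  \<comment> \<open>A bound by \<open>fact (n - 1)\<close> for each summand suffices: the
    \<open>n\<close> summands together restore \<open>fact n\<close>.\<close>
  have "norm S \<le> (\<Sum>m=1..n. q ^ n / sqrt t * M * fact (n - 1))"
    unfolding S_def
  proof (rule sum_norm_le)
    fix m assume m: "m \<in> {1..n}"
    define i where "i = n - m"
    \<comment> \<open>The factorials from the Gamma quotient and from the derivative at 0 therefore
      multiply to at most \<open>fact (n - 1)\<close>.\<close>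
    have im: "i + (m - 1) = n - 1" using m by (auto simp: i_def)
    have tp: "t powr (real i + 1/2) = t ^ i * sqrt t"
      using t by (simp add: powr_add powr_realpow powr_half_sqrt)
    have G: "0 < Gamma (real i + 1/2)" "0 < Gamma (1/2 :: real)"
      by (intro Gamma_real_pos; simp)+
    have "\<bar>(-1) ^ i * Gamma (real i + 1/2) / (t powr (real i + 1/2) * Gamma (1/2))\<bar>
          = (1 / t) ^ i / sqrt t * (Gamma (real i + 1/2) / Gamma (1/2))"
      unfolding tp abs_mult abs_divide using t G by (simp add: power_abs power_one_over)
    also have "\<dots> \<le> q ^ i / sqrt t * fact i"
      by (intro mult_mono divide_right_mono power_mono q Gamma_add_half_le_fact) (use t q G in auto)
    finally have a: "norm (of_real ((-1) ^ i * Gamma (real i + 1/2)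
        / (t powr (real i + 1/2) * Gamma (1/2))) :: complex) \<le> q ^ i / sqrt t * fact i"
      by (simp only: norm_of_real)
    have b: "norm ((deriv ^^ (m - 1)) f 0) \<le> M * q ^ (m - 1) * fact (m - 1)"
      using bq[of 0] t by simp
    have "fact i * fact (m - 1) dvd (fact (n - 1) :: nat)"
      using fact_fact_dvd_fact[of i "m - 1"] unfolding im .
    then have "fact i * fact (m - 1) \<le> (fact (n - 1) :: nat)"
      by (rule dvd_imp_le) simp
    then have "real (fact i * fact (m - 1)) \<le> real (fact (n - 1))"
      by (rule of_nat_mono)
    then have c: "fact i * fact (m - 1) \<le> (fact (n - 1) :: real)" by simp
    have "q ^ i / sqrt t * fact i * (M * q ^ (m - 1) * fact (m - 1))
          = q ^ (n - 1) / sqrt t * M * (fact i * fact (m - 1))"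
      unfolding im[symmetric] power_add by simp
    also have "\<dots> \<le> q ^ n / sqrt t * M * fact (n - 1)"
      by (intro mult_mono divide_right_mono power_increasing c) (use q t M in auto)
    finally show "norm (of_real ((-1) ^ (n - m) * Gamma (real (n - m) + 1/2)
        / (t powr (real (n - m) + 1/2) * Gamma (1/2))) * (deriv ^^ (m - 1)) f 0)
        \<le> q ^ n / sqrt t * M * fact (n - 1)"
      unfolding i_def[symmetric] norm_mult
      by (intro order_trans[OF mult_mono[OF a b]]) (use q t in auto)
  qed
  also have "\<dots> = q ^ n / sqrt t * M * (real n * fact (n - 1))" by simp
  also have "\<dots> \<le> q ^ n / sqrt t * M * fact n"
    by (rule mult_left_mono) (use q t M in \<open>cases n; simp\<close>)+
  finally have S: "norm S \<le> M * (1 / sqrt t) * q ^ n * fact n" by (simp add: mult_ac)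
  have "continuous_on {0..t} (\<lambda>s. (deriv ^^ n) f (of_real s))"
    by (rule continuous_on_compose2[OF holomorphic_on_imp_continuous_on,
          OF analytic_imp_holomorphic, OF analytic_higher_deriv[OF f]])
       (use t closed_segment_of_real[of 0 t] in
         \<open>auto intro!: continuous_intros simp: closed_segment_eq_real_ivl\<close>)
  then have "norm I \<le> 2 * sqrt t * (M * q ^ n * fact n)"
    unfolding I_def by (rule norm_half_integral_le[OF t]) (use bq in auto)
  with S have "norm (S + I) \<le> M * (1 / sqrt t) * q ^ n * fact n + 2 * sqrt t * (M * q ^ n * fact n)"
    by (intro norm_triangle_le) simp
  also have "\<dots> = M * (1 / sqrt t + 2 * sqrt t) * q ^ n * fact n"
    by (simp add: algebra_simps)
  finally have SI: "norm (S + I) \<le> M * (1 / sqrt t + 2 * sqrt t) * q ^ n * fact n" .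
  have "sqrt pi \<le> pi"
    using pi_gt3 by (intro real_le_lsqrt) (auto simp: power2_eq_square)
  then have "norm (of_real (Gamma (1/2) / pi) :: complex) \<le> 1"
    by (simp add: Gamma_one_half_real norm_divide)
  then have "norm (of_real (Gamma (1/2) / pi) * (S + I)) \<le> norm (S + I)"
    unfolding norm_mult by (intro mult_left_le_one_le) auto
  with SI show ?thesis unfolding rl_deriv_minus_half_def S_def I_def by linarith
qed

text \<open>The closed \<open>r\<close>-neighbourhood of \<open>K\<close> is compact, so
  \<open>f\<close> is bounded on it by some \<open>M\<close>. It contains the closed disc of radius
  \<open>r\<close> about every point of \<open>K\<close>, so Cauchy's inequality applies with the
  same \<open>M\<close> and \<open>r\<close> throughout.\<close>

lemma deriv_bound_near_segment:
  fixes f :: "complex \<Rightarrow> complex"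
  assumes r: "0 < r" and K: "compact K" "K \<noteq> {}" and f: "f analytic_on {z. infdist z K \<le> r}"
  obtains M where "\<And>n z. z \<in> K \<Longrightarrow> norm ((deriv ^^ n) f z) \<le> M * (1 / r) ^ n * fact n"
proof -
  define D where "D = {z. infdist z K \<le> r}"
  have hol: "f holomorphic_on D" using f unfolding D_def by (rule analytic_imp_holomorphic)
  have "compact D" unfolding D_def by (rule compact_infdist_le[OF K(2,1) r])
  then have "bounded (f ` D)"
    by (intro compact_imp_bounded compact_continuous_image holomorphic_on_imp_continuous_on[OF hol])
  then obtain M where M: "\<And>z. z \<in> D \<Longrightarrow> norm (f z) \<le> M"
    unfolding bounded_iff by auto
  have "norm ((deriv ^^ n) f z) \<le> M * (1 / r) ^ n * fact n" if z: "z \<in> K" for n z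
  proof -
    have sub: "cball z r \<subseteq> D"
    proof
      fix w assume "w \<in> cball z r"
      then show "w \<in> D"
        using infdist_le[OF z, of w] by (simp add: D_def dist_commute)
    qed
    have "norm ((deriv ^^ n) f z) \<le> fact n * M / r ^ n"
    proof (rule Cauchy_inequality[OF _ _ r])
      show "f holomorphic_on ball z r"
        by (rule holomorphic_on_subset[OF hol]) (use sub ball_subset_cball in blast)
      show "continuous_on (cball z r) f"
        by (rule holomorphic_on_imp_continuous_on[OF holomorphic_on_subset[OF hol sub]])
      show "norm (f w) \<le> M" if "norm (z - w) = r" for w
        by (rule M) (use sub that in \<open>auto simp: dist_norm\<close>)
    qed
    then show ?thesis by (simp add: power_one_over mult_ac)
  qed
  then show thesis by (rule that)
qed

theorem theorem2:
  fixes f :: "complex \<Rightarrow> complex" and r T :: real and D :: "complex set"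
  assumes "r > 0" and "T > 0"
    and "D = {t. infdist t (closed_segment 0 (of_real T)) \<le> r}"
    and "f analytic_on D"
  shows "\<forall>t\<in>{0..T}.
           (\<forall>x::complex. summable (\<lambda>n. (-1) ^ n * x ^ n / fact n * rl_half_deriv f n t)) \<and>
           (\<lambda>x. \<Sum>n. (-1) ^ n * x ^ n / fact n * rl_half_deriv f n t) holomorphic_on UNIV"
proof
  fix t assume t: "t \<in> {0..T}"
  have seg: "of_real s \<in> closed_segment 0 (of_real T :: complex)" if "s \<in> {0..T}" for s
    using that closed_segment_of_real[of 0 T] by (auto simp: closed_segment_eq_real_ivl)
  obtain M where "\<And>n z. z \<in> closed_segment 0 (of_real T) \<Longrightarrow>
      norm ((deriv ^^ n) f z) \<le> M * (1 / r) ^ n * fact n"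
    using deriv_bound_near_segment[OF \<open>r > 0\<close> _ _ assms(4)[unfolded assms(3)]] by auto
  then have bound: "norm ((deriv ^^ n) f (of_real s)) \<le> M * (1 / r) ^ n * fact n"
    if "s \<in> {0..T}" for n s using seg[OF that] by blast
  have M: "0 \<le> M"
    using order_trans[OF norm_ge_zero bound[of 0 0]] \<open>T > 0\<close> by simp
  \<comment> \<open>The entry 1 makes powers of \<open>q\<close> monotone in the exponent,
    \<open>1 / r\<close> comes from Cauchy's inequality and \<open>1 / t\<close> from the boundary
    terms. At \<open>t = 0\<close> the last entry is 0.\<close>
  define q where "q = Max {1, 1 / r, 1 / t}"
  have q: "1 \<le> q" "1 / r \<le> q" "1 / t \<le> q" by (auto simp: q_def)
  \<comment> \<open>The summand 1 serves the integer orders, the other two the half-integer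
    orders.\<close>
  define A where "A = M * (1 + 1 / sqrt t + 2 * sqrt t)"
  have A: "0 \<le> A" "M \<le> A" "M * (1 / sqrt t + 2 * sqrt t) \<le> A"
    using t M mult_left_mono[of 1 "1 + 1 / sqrt t + 2 * sqrt t" M]
    by (auto simp: A_def mult_left_mono)
  have main: "norm (rl_half_deriv f k t) \<le> A * q ^ ((k + 1) div 2) * fact ((k + 1) div 2)" for k
  proof (cases "even k")
    case True
    then have "norm (rl_half_deriv f k t) \<le> M * (1 / r) ^ (k div 2) * fact (k div 2)"
      using bound[OF t] by (simp add: rl_half_deriv_def)
    also have "\<dots> \<le> A * q ^ (k div 2) * fact (k div 2)"
      by (intro mult_mono power_mono A q) (use A \<open>r > 0\<close> q in auto)
    finally show ?thesis using True by simp
  next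
    case odd: False
    show ?thesis
    proof (cases "t = 0")
      \<comment> \<open>At \<open>t = 0\<close> the odd orders take the default value 0: the
        boundary terms are divisions by zero and the integral is over a point.\<close>
      case True
      then show ?thesis using odd A q by (simp add: rl_half_deriv_def rl_deriv_minus_half_def)
    next
      case False
      then have "0 < t" using t by auto
      have "f analytic_on closed_segment 0 (of_real t)"
      proof (rule analytic_on_subset[OF assms(4)])
        have "closed_segment 0 (of_real t) \<subseteq> closed_segment 0 (of_real T :: complex)"
          using seg[OF t] by (simp add: subset_closed_segment)
        then show "closed_segment 0 (of_real t) \<subseteq> D"
          using \<open>r > 0\<close> by (auto simp: assms(3) in_mono)
      qed
      then have "norm (rl_half_deriv f k t)
          \<le> M * (1 / sqrt t + 2 * sqrt t) * q ^ ((k + 1) div 2) * fact ((k + 1) div 2)"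
        unfolding rl_half_deriv_def if_not_P[OF odd]
        by (rule norm_rl_deriv_minus_half_le[OF _ \<open>0 < t\<close> bound])
           (use t q \<open>r > 0\<close> in auto)
      also have "\<dots> \<le> A * q ^ ((k + 1) div 2) * fact ((k + 1) div 2)"
        by (intro mult_right_mono A) (use q in auto)
      finally show ?thesis .
    qed
  qed
  \<comment> \<open>As \<open>(k + 1) div 2 \<le> k\<close> and \<open>1 \<le> q\<close>, the power
    of \<open>q\<close> can be enlarged to the form that the entireness lemma expects.\<close>
  have le: "norm (rl_half_deriv f k t) \<le> A * q ^ k * fact ((k + 1) div 2)" for k
    by (rule order_trans[OF main], intro mult_right_mono mult_left_mono power_increasing)
       (use A q in auto)
  show "(\<forall>x::complex. summable (\<lambda>n. (-1) ^ n * x ^ n / fact n * rl_half_deriv f n t)) \<and>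
        (\<lambda>x. \<Sum>n. (-1) ^ n * x ^ n / fact n * rl_half_deriv f n t) holomorphic_on UNIV"
    using entire_of_fact_half_bound[OF le q(1)] by blast
qed

end
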